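(* For all integers $m \leq s \leq d$ and for every finite field $\mathbb{F}$, \[\mathrm{minrk}_{\mathbb{F}}(K(d,s,m)) \leq \sum_{i=0}^{s-m}\binom{d}{i}.\] Moreover, this bound can be achieved by a symmetric matrix, i.e., there is a symmetric matrix over $\mathbb{F}$ representing $K(d,s,m)$ whose rank is at most $\sum_{i=0}^{s-m}\binom{d}{i}$.
   Context: For integers $m \leq s \leq d$, the generalized Kneser graph $K(d,s,m)$ has as vertices all $s$-subsets of $[d]$, two sets $A,B$ being adjacent if $|A\cap B| < m$. For a graph $G$ on vertex set $V$ with $|V|=n$ and a field $\mathbb{F}$, an $n\times n$ matrix $M$ over $\mathbb{F}$ indexed by $V$ represents $G$ if $M_{v,v}\neq 0$ for all $v$ and $M_{u,v}=0$ for all distinct non-adjacent $u,v$; $\mathrm{minrk}_{\mathbb{F}}(G)$ is the minimum rank over $\mathbb{F}$ of a matrix representing $G$. *)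

theory Defs
  imports
    Complex_Main
    "HOL-Library.Function_Algebras"
    "Graph_Theory.Pair_Digraph"
begin

(* Simple graphs are the pair_graph instances of pair_pre_digraph: a finite vertex set pverts G
   and a symmetric irreflexive arc relation parcs G. *)

text \<open>The generalized Kneser graph. The threshold \<open>m\<close> is an arbitrary integer;
  for \<open>m \<le> 0\<close> the graph has no edges.\<close>

definition kneser_graph :: "nat \<Rightarrow> nat \<Rightarrow> int \<Rightarrow> nat set pair_pre_digraph" where
  "kneser_graph d s m =
    (let V = {A. A \<subseteq> {1..d} \<and> card A = s}
     in \<lparr> pverts = V, parcs = {(A, B). A \<in> V \<and> B \<in> V \<and> int (card (A \<inter> B)) < m} \<rparr>)"

lemma pair_graph_kneser_graph:
  assumes "m \<le> int s"
  shows "pair_graph (kneser_graph d s m)"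
proof -
  let ?V = "{A. A \<subseteq> {1..d} \<and> card A = s}"
  let ?E = "{(A, B). A \<in> ?V \<and> B \<in> ?V \<and> int (card (A \<inter> B)) < m}"
  have V: "pverts (kneser_graph d s m) = ?V" and E: "parcs (kneser_graph d s m) = ?E"
    by (simp_all only: kneser_graph_def Let_def pair_pre_digraph.select_convs)
  have "?V \<subseteq> Pow {1..d}"
    by blast
  then have finV: "finite ?V"
    by (rule finite_subset) simp
  have "?E \<subseteq> ?V \<times> ?V"
    by blast
  then have finE: "finite ?E"
    by (rule finite_subset) (intro finite_cartesian_product finV)
  have ends: "A \<in> ?V" "B \<in> ?V" "card (A \<inter> B) < s" if "(A, B) \<in> ?E" for A B
    using that assms by simp_all
  have ends': "fst e \<in> ?V" "snd e \<in> ?V" if "e \<in> ?E" for e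
    using that ends[of "fst e" "snd e"] by (simp_all only: prod.collapse)
  have irrefl: "fst e \<noteq> snd e" if "e \<in> ?E" for e
  proof
    assume eq: "fst e = snd e"
    have "(fst e, snd e) \<in> ?E"
      using that by (simp only: prod.collapse)
    from ends(2,3)[OF this] show False
      by (simp add: eq)
  qed
  have "(B, A) \<in> ?E" if "(A, B) \<in> ?E" for A B
    using that by (simp only: mem_Collect_eq prod.case Int_commute[of B A])
  then have "sym ?E"
    by (rule symI)
  then have sym: "symmetric (with_proj (kneser_graph d s m))"
    by (simp only: symmetric_def arcs_ends_conv with_proj_simps E prod.collapse image_ident)
  show ?thesis
    by unfold_locales (use ends' finV finE irrefl sym in \<open>simp_all only: V E simp_thms\<close>)
qed

text \<open>A matrix with rows and columns indexed by a finite set \<open>V\<close> is a function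
  \<open>M :: 'v \<Rightarrow> 'v \<Rightarrow> 'a\<close>, of which only the entries \<open>M u v\<close> with \<open>u, v \<in> V\<close> matter.
  Its rank is the dimension of its column space; columns are taken as functions vanishing
  outside \<open>V\<close>, so entries outside \<open>V \<times> V\<close> do not contribute.\<close>

interpretation fun_space: vector_space "\<lambda>(c :: 'a :: field) (f :: 'v \<Rightarrow> 'a) v. c * f v"
  by unfold_locales
    (auto simp only: fun_eq_iff plus_fun_apply distrib_left distrib_right mult.assoc mult_1_left)

definition mat_rank :: "'v set \<Rightarrow> ('v \<Rightarrow> 'v \<Rightarrow> 'a :: field) \<Rightarrow> nat" where
  "mat_rank V M = fun_space.dim ((\<lambda>v u. if u \<in> V then M u v else 0) ` V)"

definition symmetric_mat :: "'v set \<Rightarrow> ('v \<Rightarrow> 'v \<Rightarrow> 'a) \<Rightarrow> bool" where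
  "symmetric_mat V M \<longleftrightarrow> (\<forall>u\<in>V. \<forall>v\<in>V. M u v = M v u)"

definition represents :: "('v \<Rightarrow> 'v \<Rightarrow> 'a :: field) \<Rightarrow> 'v pair_pre_digraph \<Rightarrow> bool" where
  "represents M G \<longleftrightarrow>
    (\<forall>v\<in>pverts G. M v v \<noteq> 0) \<and>
    (\<forall>u\<in>pverts G. \<forall>v\<in>pverts G. u \<noteq> v \<and> (u, v) \<notin> parcs G \<longrightarrow> M u v = 0)"

definition minrk :: "'a :: field itself \<Rightarrow> 'v pair_pre_digraph \<Rightarrow> nat" where
  "minrk _ G = (LEAST r. \<exists>M :: 'v \<Rightarrow> 'v \<Rightarrow> 'a. represents M G \<and> mat_rank (pverts G) M = r)"

lemma minrk_attained:
  "\<exists>M :: 'v \<Rightarrow> 'v \<Rightarrow> 'a :: field. represents M G \<and> mat_rank (pverts G) M = minrk TYPE('a) G"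
proof -
  have "represents (\<lambda>u v. if u = v then 1 else 0 :: 'a) G"
    by (auto simp: represents_def)
  then have "\<exists>r. \<exists>M :: 'v \<Rightarrow> 'v \<Rightarrow> 'a. represents M G \<and> mat_rank (pverts G) M = r"
    by blast
  then show ?thesis
    unfolding minrk_def by (rule LeastI_ex)
qed

end

theory Submission
  imports Defs
begin

text \<open>The polynomial \<open>x \<mapsto> (x - m choose k)\<close>, \<open>k = s - m\<close>, takes the value 1 at \<open>s\<close> and vanishes at
  \<open>m, \<dots>, s - 1\<close>, so \<open>M A B = (card (A \<inter> B) - m choose k)\<close> represents the graph. Being
  integer-valued, the polynomial is an integer combination of the \<open>(x choose i)\<close>, \<open>i \<le> k\<close>, whatever the
  characteristic, and
  \<open>(card (A \<inter> B) choose i)\<close> counts the \<open>i\<close>-sets \<open>I\<close> contained in both \<open>A\<close> and \<open>B\<close>. Hence every column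
  of \<open>M\<close> is a combination of the indicators of \<open>I \<subseteq> A\<close> for \<open>card I \<le> k\<close>.\<close>

text \<open>Pascal's rule, \<open>(x-n choose k+1) = (x-n-1 choose k+1) + (x-n-1 choose k)\<close>,
  yields the coefficients for \<open>(n+1, k+1)\<close> from those for \<open>(n, k+1)\<close> and
  \<open>(n+1, k)\<close>; hence the nested induction. Below \<open>n\<close> the truncated
  difference may depart from the polynomial.\<close>

lemma binomial_shift_expansion_nat:
  fixes n k :: nat
  shows "\<exists>c :: nat \<Rightarrow> int. \<forall>x\<ge>n. (\<Sum>i\<le>k. c i * int (x choose i)) = int ((x - n) choose k)"
proof (induction n arbitrary: k)
  case 0
  show ?case
    by (rule exI[of _ "\<lambda>i. if i = k then 1 else 0"]) (simp add: if_distrib[of "\<lambda>z. z * _"] cong: if_cong)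
next
  case (Suc n)
  note shift = Suc.IH
  show ?case
  proof (induction k)
    case 0
    show ?case
      by (rule exI[of _ "\<lambda>_. 1"]) simp
  next
    case (Suc k)
    then obtain a :: "nat \<Rightarrow> int" where a:
      "\<And>x. Suc n \<le> x \<Longrightarrow> (\<Sum>i\<le>k. a i * int (x choose i)) = int ((x - Suc n) choose k)"
      by blast
    obtain b :: "nat \<Rightarrow> int" where b:
      "\<And>x. n \<le> x \<Longrightarrow> (\<Sum>i\<le>Suc k. b i * int (x choose i)) = int ((x - n) choose Suc k)"
      using shift by blast
    show ?case
    proof (intro exI allI impI)
      fix x assume x: "Suc n \<le> x"
      \<comment> \<open>The coefficients \<open>a\<close> stop at degree \<open>k\<close>, so they
        are padded with 0 at \<open>Suc k\<close>.\<close>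
      have "(\<Sum>i\<le>Suc k. (b i - (if i \<le> k then a i else 0)) * int (x choose i))
        = (\<Sum>i\<le>Suc k. b i * int (x choose i)) - (\<Sum>i\<le>k. a i * int (x choose i))"
        by (simp add: left_diff_distrib sum_subtractf)
      also have "\<dots> = int ((x - n) choose Suc k) - int ((x - Suc n) choose k)"
        by (simp only: a[OF x] b[OF Suc_leD[OF x]])
      also have "\<dots> = int ((x - Suc n) choose Suc k)"
        using Suc_diff_Suc[of n x] x binomial_Suc_Suc[of "x - Suc n" k] by simp
      finally show "(\<Sum>i\<le>Suc k. (b i - (if i \<le> k then a i else 0)) * int (x choose i))
        = int ((x - Suc n) choose Suc k)" .
    qed
  qed
qed

lemma binomial_shift_expansion:
  fixes m :: int and k :: nat
  shows "\<exists>c :: nat \<Rightarrow> int. \<forall>x. m \<le> int x \<longrightarrow>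
    (\<Sum>i\<le>k. c i * int (x choose i)) = int (nat (int x - m) choose k)"
proof (cases "m \<ge> 0")
  case True
  then obtain n where "m = int n"
    using nonneg_int_cases by blast
  then show ?thesis
    using binomial_shift_expansion_nat[of n k] by (simp add: nat_minus_as_int)
next
  case False
  then obtain n where n: "m = - int n"
    using nonpos_int_cases[of m] by auto
  \<comment> \<open>For negative \<open>m\<close> the argument is \<open>x + n\<close>, and
    Vandermonde's identity supplies the coefficients directly.\<close>
  have "(\<Sum>i\<le>k. int (n choose (k - i)) * int (x choose i)) = int (nat (int x - m) choose k)" for x
  proof -
    have "nat (int x - m) = x + n"
      using n by simp
    then show ?thesis
      using vandermonde[of x n k] by (simp add: mult.commute flip: of_nat_mult of_nat_sum)
  qed
  then show ?thesis
    by (intro exI[of _ "\<lambda>i. int (n choose (k - i))"]) simp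
qed

lemma sum_apply: "(\<Sum>j\<in>J. f j) x = (\<Sum>j\<in>J. f j x)"
  for f :: "'i \<Rightarrow> 'v \<Rightarrow> 'a :: comm_monoid_add"
  by (induction J rule: infinite_finite_induct) auto

text \<open>A factorization through \<open>J\<close> puts column \<open>v\<close> in the span of the
  vectors \<open>f j\<close>, with coefficients \<open>g j v\<close>.\<close>

lemma mat_rank_le_card:
  fixes M :: "'v \<Rightarrow> 'v \<Rightarrow> 'a :: field"
  assumes "finite J"
    and "\<And>u v. u \<in> V \<Longrightarrow> v \<in> V \<Longrightarrow> M u v = (\<Sum>j\<in>J. f j u * g j v)"
  shows "mat_rank V M \<le> card J"
proof -
  define w where "w = (\<lambda>j u. if u \<in> V then f j u else 0)"
  have "(\<lambda>u. if u \<in> V then M u v else 0) \<in> fun_space.span (w ` J)" if "v \<in> V" for v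
  proof -
    have "(\<lambda>u. if u \<in> V then M u v else 0) = (\<Sum>j\<in>J. (\<lambda>u. g j v * w j u))"
      using assms that by (auto simp: fun_eq_iff w_def sum_apply mult.commute intro!: sum.cong)
    then show ?thesis
      by (simp only:) (intro fun_space.span_sum fun_space.span_scale fun_space.span_base imageI)
  qed
  then have "mat_rank V M \<le> card (w ` J)"
    unfolding mat_rank_def using assms(1) by (intro fun_space.dim_le_card) auto
  also have "\<dots> \<le> card J"
    using assms(1) by (rule card_image_le)
  finally show ?thesis .
qed

lemma card_subsets_card_le:
  assumes "finite S"
  shows "card {I. I \<subseteq> S \<and> card I \<le> k} = (\<Sum>i\<le>k. card S choose i)"
proof -
  have "{I. I \<subseteq> S \<and> card I \<le> k} = (\<Union>i\<le>k. {I. I \<subseteq> S \<and> card I = i})"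
    by auto
  also have "card \<dots> = (\<Sum>i\<le>k. card {I. I \<subseteq> S \<and> card I = i})"
    using assms by (intro card_UN_disjoint) auto
  finally show ?thesis
    using assms by (simp add: n_subsets)
qed

text \<open>With \<open>S = A \<inter> B\<close> this turns an entry of the matrix into a sum over
  sets \<open>I\<close>, where \<open>I \<subseteq> A \<inter> B\<close> splits into a condition on
  \<open>A\<close> and one on \<open>B\<close>.\<close>

lemma sum_subsets_card_le:
  fixes c :: "nat \<Rightarrow> 'a :: comm_semiring_1"
  assumes "finite S"
  shows "(\<Sum>I | I \<subseteq> S \<and> card I \<le> k. c (card I)) = (\<Sum>i\<le>k. c i * of_nat (card S choose i))"
proof -
  have "(\<Sum>I | I \<subseteq> S \<and> card I \<le> k. c (card I)) =
      (\<Sum>i\<le>k. \<Sum>I | I \<in> {I. I \<subseteq> S \<and> card I \<le> k} \<and> card I = i. c (card I))"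
    using assms by (intro sum.group[symmetric]) auto
  also have "\<dots> = (\<Sum>i\<le>k. \<Sum>I | I \<subseteq> S \<and> card I = i. c i)"
    by (intro sum.cong) auto
  finally show ?thesis
    using assms by (simp add: n_subsets mult.commute)
qed

theorem theorem3p2:
  fixes m :: int and s d :: nat
  assumes "m \<le> int s" and "s \<le> d"
  shows "minrk TYPE('a :: {finite, field}) (kneser_graph d s m)
           \<le> (\<Sum>i = 0..nat (int s - m). d choose i) \<and>
         (\<exists>M :: nat set \<Rightarrow> nat set \<Rightarrow> 'a.
            represents M (kneser_graph d s m) \<and>
            symmetric_mat (pverts (kneser_graph d s m)) M \<and>
            mat_rank (pverts (kneser_graph d s m)) M \<le> (\<Sum>i = 0..nat (int s - m). d choose i))"
proof -
  define k where "k = nat (int s - m)"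
  define V where "V = {A. A \<subseteq> {1..d} \<and> card A = s}"
  define J where "J = {I. I \<subseteq> {1..d} \<and> card I \<le> k}"
  have verts: "pverts (kneser_graph d s m) = V"
    and arcs: "parcs (kneser_graph d s m) = {(A, B). A \<in> V \<and> B \<in> V \<and> int (card (A \<inter> B)) < m}"
    by (simp_all add: kneser_graph_def V_def Let_def)
  obtain c :: "nat \<Rightarrow> int" where c: "\<And>x. m \<le> int x \<Longrightarrow>
      (\<Sum>i\<le>k. c i * int (x choose i)) = int (nat (int x - m) choose k)"
    using binomial_shift_expansion by blast
  \<comment> \<open>The expansion itself is the entry. It equals the shifted binomial once
    \<open>card (A \<inter> B)\<close> is at least \<open>m\<close>, which covers the diagonal and
    all non-edges; entries on edges are unconstrained.\<close>
  define M :: "nat set \<Rightarrow> nat set \<Rightarrow> 'a" where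
    "M A B = of_int (\<Sum>i\<le>k. c i * int (card (A \<inter> B) choose i))" for A B
  have fin: "finite A" if "A \<in> V" for A
    using that by (auto simp: V_def intro: finite_subset)
  \<comment> \<open>The value at \<open>s\<close> is \<open>k choose k = 1\<close>, nonzero in every
    field.\<close>
  have diag: "M A A \<noteq> 0" if "A \<in> V" for A
    using that assms c[of s] by (simp add: M_def V_def k_def)
  have off_diag: "M A B = 0" if "A \<in> V" "B \<in> V" "A \<noteq> B" "\<not> int (card (A \<inter> B)) < m" for A B
  proof -
    have card: "card A = s" "card B = s"
      using that by (simp_all add: V_def)
    then have "\<not> A \<subseteq> B"
      using card_subset_eq[OF fin[OF that(2)], of A] that(3) by auto
    then have "A \<inter> B \<subset> A"
      by blast
    then have "card (A \<inter> B) < s"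
      using psubset_card_mono[OF fin[OF that(1)], of "A \<inter> B"] card(1) by simp
    \<comment> \<open>Since \<open>m \<le> card (A \<inter> B) < s\<close>, the upper index drops
      strictly below \<open>k\<close>, so the binomial vanishes.\<close>
    then have "nat (int (card (A \<inter> B)) - m) < k"
      using that by (simp add: k_def)
    then show ?thesis
      using c[of "card (A \<inter> B)"] that by (simp add: M_def binomial_eq_0)
  qed
  have rep: "represents M (kneser_graph d s m)"
    using diag off_diag by (auto simp: represents_def verts arcs)
  have sym: "symmetric_mat V M"
    by (simp add: symmetric_mat_def M_def Int_commute)
  have "M A B = (\<Sum>I\<in>J. of_bool (I \<subseteq> A) * (of_bool (I \<subseteq> B) * of_int (c (card I))))"
    if "A \<in> V" "B \<in> V" for A B
  proof -
    have "M A B = (\<Sum>I | I \<subseteq> A \<inter> B \<and> card I \<le> k. of_int (c (card I)))"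
      using that fin by (subst sum_subsets_card_le) (auto simp: M_def)
    \<comment> \<open>Extending the sum to all of \<open>J\<close> adds only zero terms and makes
      the index set independent of \<open>A\<close> and \<open>B\<close>.\<close>
    also have "\<dots> = (\<Sum>I\<in>J. of_bool (I \<subseteq> A) * (of_bool (I \<subseteq> B) * of_int (c (card I))))"
      using that by (intro sum.mono_neutral_cong_left) (auto simp: J_def V_def)
    finally show ?thesis .
  qed
  then have "mat_rank V M \<le> card J"
    by (intro mat_rank_le_card[where f = "\<lambda>I A. of_bool (I \<subseteq> A)"
          and g = "\<lambda>I B. of_bool (I \<subseteq> B) * of_int (c (card I))"]) (simp add: J_def, simp only:)
  then have rank: "mat_rank V M \<le> (\<Sum>i = 0..k. d choose i)"
    using card_subsets_card_le[of "{1..d}" k] by (simp add: J_def atMost_atLeast0)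
  have "minrk TYPE('a) (kneser_graph d s m) \<le> mat_rank V M"
    unfolding minrk_def using rep verts by (intro Least_le) auto
  then show ?thesis
    using rep sym rank unfolding verts k_def by auto
qed

end
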